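(* Let $n\ge1$, let $R=\mathbb{H}[x_1,\dots,x_n]$ be the ring of quaternionic polynomial functions $\mathbb{H}^n\to\mathbb{H}$, and let $I$ be a (two-sided) ideal of $R$. Then the quaternionic radical $\sqrt[\mathbb{H}]{I}$ is the intersection of all prime quaternionic ideals of $R$ containing $I$ (an empty intersection being understood as $R$).
   Context: $\mathbb{H}$ is Hamilton's algebra of real quaternions, with conjugation $\overline{a+b\boldsymbol{i}+c\boldsymbol{j}+d\boldsymbol{k}}=a-b\boldsymbol{i}-c\boldsymbol{j}-d\boldsymbol{k}$. The ring $R=\mathbb{H}[x_1,\dots,x_n]$ consists of all functions $f:\mathbb{H}^n\to\mathbb{H}$ expressible as finite sums of terms $a_1x_{\mu_1}a_2x_{\mu_2}\cdots a_kx_{\mu_k}a_{k+1}$ with $k\ge 0$, $a_p\in\mathbb{H}$, $\mu_p\in\{1,\dots,n\}$, under pointwise addition and multiplication. For $f\in R$, $\overline f$ is the function $\overline f(a)=\overline{f(a)}$, which again belongs to $R$. All ideals are two-sided. An ideal $I\subseteq R$ is called quaternionic if for all $f_1,\dots,f_k\in R$, $\sum f_i\overline{f_i}\in I$ implies $f_i\in I$ for all $i$. The quaternionic radical of an ideal $I$ is $$\sqrt[\mathbb{H}]{I}=\Big\{ f\in R:\ \exists\, m\ge 1,\ k\ge 0,\ f_1,\dots,f_k\in R \text{ such that } (f\overline f)^m+\sum_{i=1}^k f_i\overline{f_i}\in I\Big\}.$$ An ideal $P$ of $R$ is prime (in Krull's sense) if for all $a,b\in R$ with $(a)(b)\subseteq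 P$, where $(u)$ is the two-sided ideal generated by $u$, one has $(a)\subseteq P$ or $(b)\subseteq P$. *)

theory Defs
  imports "HOL-Analysis.Finite_Cartesian_Product" "HOL-Algebra.Ideal_Product"
begin

section \<open>Real quaternions\<close>

datatype quat = Quat (qRe: real) (qI: real) (qJ: real) (qK: real)

instantiation quat :: ring_1
begin

definition zero_quat :: quat where "0 = Quat 0 0 0 0"

definition one_quat :: quat where "1 = Quat 1 0 0 0"

definition uminus_quat :: "quat \<Rightarrow> quat" where
  "- p = Quat (- qRe p) (- qI p) (- qJ p) (- qK p)"

definition plus_quat :: "quat \<Rightarrow> quat \<Rightarrow> quat" where
  "p + q = Quat (qRe p + qRe q) (qI p + qI q) (qJ p + qJ q) (qK p + qK q)"

definition minus_quat :: "quat \<Rightarrow> quat \<Rightarrow> quat" where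
  "p - q = Quat (qRe p - qRe q) (qI p - qI q) (qJ p - qJ q) (qK p - qK q)"

definition times_quat :: "quat \<Rightarrow> quat \<Rightarrow> quat" where
  "p * q = Quat
     (qRe p * qRe q - qI p * qI q - qJ p * qJ q - qK p * qK q)
     (qRe p * qI q + qI p * qRe q + qJ p * qK q - qK p * qJ q)
     (qRe p * qJ q - qI p * qK q + qJ p * qRe q + qK p * qI q)
     (qRe p * qK q + qI p * qJ q - qJ p * qI q + qK p * qRe q)"

instance
  by standard
    (simp_all add: zero_quat_def one_quat_def uminus_quat_def plus_quat_def
      minus_quat_def times_quat_def algebra_simps)

end

definition qcnj :: "quat \<Rightarrow> quat" where
  "qcnj q = Quat (qRe q) (- qI q) (- qJ q) (- qK q)"

lemma hamilton_relations:
  defines "i \<equiv> Quat 0 1 0 0" and "j \<equiv> Quat 0 0 1 0" and "k \<equiv> Quat 0 0 0 1"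
  shows "i * i = - 1" "j * j = - 1" "k * k = - 1" "i * j = k" "j * k = i" "k * i = j"
  by (simp_all add: i_def j_def k_def times_quat_def one_quat_def uminus_quat_def)

section \<open>Quaternionic polynomial functions\<close>

text \<open>The list \<open>[(a\<^sub>1, \<mu>\<^sub>1), \<dots>, (a\<^sub>k, \<mu>\<^sub>k)]\<close> together with \<open>c\<close> encodes the
  generalized monomial \<open>a\<^sub>1 x\<^bsub>\<mu>\<^sub>1\<^esub> \<cdots> a\<^sub>k x\<^bsub>\<mu>\<^sub>k\<^esub> c\<close>; coefficients and variables do not commute.\<close>

primrec qmonom :: "(quat \<times> 'n::finite) list \<Rightarrow> quat \<Rightarrow> quat ^ 'n \<Rightarrow> quat" where
  "qmonom [] c x = c"
| "qmonom (t # ts) c x = fst t * x $ snd t * qmonom ts c x"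

definition qpoly_funs :: "(quat ^ 'n::finite \<Rightarrow> quat) set" where
  "qpoly_funs = {f. \<exists>L. f = (\<lambda>x. \<Sum>(ts, c)\<leftarrow>L. qmonom ts c x)}"

definition qpoly_ring :: "(quat ^ 'n::finite \<Rightarrow> quat) ring" where
  "qpoly_ring =
    \<lparr>carrier = qpoly_funs, monoid.mult = (\<lambda>f g x. f x * g x), one = (\<lambda>x. 1),
     zero = (\<lambda>x. 0), add = (\<lambda>f g x. f x + g x)\<rparr>"

definition fun_cnj :: "('a \<Rightarrow> quat) \<Rightarrow> 'a \<Rightarrow> quat" where
  "fun_cnj f = (\<lambda>x. qcnj (f x))"

section \<open>Quaternionic ideals, the quaternionic radical, and prime ideals\<close>

definition quaternionic_ideal :: "(quat ^ 'n::finite \<Rightarrow> quat) set \<Rightarrow> bool" where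
  "quaternionic_ideal I \<longleftrightarrow> ideal I qpoly_ring \<and>
    (\<forall>(k::nat) f. f \<in> {..<k} \<rightarrow> carrier qpoly_ring \<longrightarrow>
      (\<Oplus>\<^bsub>qpoly_ring\<^esub>i\<in>{..<k}. f i \<otimes>\<^bsub>qpoly_ring\<^esub> fun_cnj (f i)) \<in> I \<longrightarrow>
      (\<forall>i<k. f i \<in> I))"

definition quaternionic_radical ::
    "(quat ^ 'n::finite \<Rightarrow> quat) set \<Rightarrow> (quat ^ 'n \<Rightarrow> quat) set" where
  "quaternionic_radical I = {f \<in> carrier qpoly_ring.
    \<exists>(m::nat) (k::nat) g. m \<ge> 1 \<and> g \<in> {..<k} \<rightarrow> carrier qpoly_ring \<and>
      (f \<otimes>\<^bsub>qpoly_ring\<^esub> fun_cnj f) [^]\<^bsub>qpoly_ring\<^esub> m \<oplus>\<^bsub>qpoly_ring\<^esub>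
      (\<Oplus>\<^bsub>qpoly_ring\<^esub>i\<in>{..<k}. g i \<otimes>\<^bsub>qpoly_ring\<^esub> fun_cnj (g i)) \<in> I}"

text \<open>The library's \<^locale>\<open>primeideal\<close> is restricted to commutative rings and elementwise
  products. The definition below does not require \<open>P\<close> to be proper.\<close>

definition krull_prime_ideal :: "'a set \<Rightarrow> ('a, 'b) ring_scheme \<Rightarrow> bool" where
  "krull_prime_ideal P R \<longleftrightarrow> ideal P R \<and>
    (\<forall>a\<in>carrier R. \<forall>b\<in>carrier R.
      ideal_prod R (genideal R {a}) (genideal R {b}) \<subseteq> P \<longrightarrow>
      genideal R {a} \<subseteq> P \<or> genideal R {b} \<subseteq> P)"

section \<open>Well-formedness of the ring of polynomial functions\<close>

lemma qpoly_ring_simps [simp]: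
  "carrier qpoly_ring = qpoly_funs"
  "f \<otimes>\<^bsub>qpoly_ring\<^esub> g = (\<lambda>x. f x * g x)"
  "f \<oplus>\<^bsub>qpoly_ring\<^esub> g = (\<lambda>x. f x + g x)"
  "\<one>\<^bsub>qpoly_ring\<^esub> = (\<lambda>x. 1)"
  "\<zero>\<^bsub>qpoly_ring\<^esub> = (\<lambda>x. 0)"
  by (simp_all add: qpoly_ring_def)

lemma qpoly_funs_zero: "(\<lambda>x. 0) \<in> qpoly_funs"
  unfolding qpoly_funs_def by (intro CollectI exI[of _ "[]"]) simp

lemma qmonom_in: "qmonom ts c \<in> qpoly_funs"
  unfolding qpoly_funs_def by (intro CollectI exI[of _ "[(ts, c)]"]) simp

lemma qpoly_funs_const: "(\<lambda>x. c) \<in> qpoly_funs"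
  unfolding qpoly_funs_def by (intro CollectI exI[of _ "[([], c)]"]) simp

lemma qpoly_funs_var: "(\<lambda>x. x $ i) \<in> qpoly_funs"
proof -
  have "qmonom [(1, i)] 1 = (\<lambda>x. x $ i)" by (rule ext) simp
  then show ?thesis using qmonom_in by metis
qed

lemma qpoly_funs_add:
  assumes "f \<in> qpoly_funs" "g \<in> qpoly_funs"
  shows "(\<lambda>x. f x + g x) \<in> qpoly_funs"
proof -
  from assms obtain L M where
    "f = (\<lambda>x. \<Sum>(ts, c)\<leftarrow>L. qmonom ts c x)" "g = (\<lambda>x. \<Sum>(ts, c)\<leftarrow>M. qmonom ts c x)"
    by (auto simp: qpoly_funs_def)
  then show ?thesis
    unfolding qpoly_funs_def by (intro CollectI exI[of _ "L @ M"]) simp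
qed

lemma qpoly_funs_induct [consumes 1, case_names zero add]:
  assumes "f \<in> qpoly_funs" and "P (\<lambda>x. 0)"
    and "\<And>ts c g. g \<in> qpoly_funs \<Longrightarrow> P g \<Longrightarrow> P (\<lambda>x. qmonom ts c x + g x)"
  shows "P f"
proof -
  have "P (\<lambda>x. \<Sum>(ts, c)\<leftarrow>L. qmonom ts c x)" for L
  proof (induction L)
    case Nil
    then show ?case using assms(2) by simp
  next
    case (Cons t L)
    have "(\<lambda>x. \<Sum>(ts, c)\<leftarrow>L. qmonom ts c x) \<in> qpoly_funs"
      by (auto simp: qpoly_funs_def)
    from assms(3)[OF this Cons] show ?case
      by (cases t) simp
  qed
  then show ?thesis using assms(1) by (auto simp: qpoly_funs_def)
qed

lemma qmonom_const_mult: "\<exists>ts' c'. (\<lambda>x. a * qmonom ts c x) = qmonom ts' c'"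
proof (cases ts)
  case Nil
  then show ?thesis by (intro exI[of _ "[]"] exI[of _ "a * c"]) (simp add: fun_eq_iff)
next
  case (Cons t us)
  then show ?thesis
    by (intro exI[of _ "(a * fst t, snd t) # us"] exI[of _ c]) (simp add: fun_eq_iff mult.assoc)
qed

lemma qmonom_mult: "\<exists>ts' c'. (\<lambda>x. qmonom ts c x * qmonom us d x) = qmonom ts' c'"
proof (induction ts)
  case Nil
  then show ?case using qmonom_const_mult[of c us d] by simp
next
  case (Cons t ts)
  then obtain ts' c' where *: "(\<lambda>x. qmonom ts c x * qmonom us d x) = qmonom ts' c'" by blast
  have "qmonom ts c x * qmonom us d x = qmonom ts' c' x" for x
    using fun_cong[OF *, of x] by simp
  then show ?case
    by (intro exI[of _ "t # ts'"] exI[of _ c']) (simp add: fun_eq_iff mult.assoc)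
qed

lemma qpoly_funs_mult:
  assumes "f \<in> qpoly_funs" "g \<in> qpoly_funs"
  shows "(\<lambda>x. f x * g x) \<in> qpoly_funs"
proof -
  have mono: "(\<lambda>x. qmonom ts c x * g x) \<in> qpoly_funs" for ts c
    using assms(2)
  proof (induction g rule: qpoly_funs_induct)
    case zero
    then show ?case by (simp add: qpoly_funs_zero)
  next
    case (add us d g)
    obtain ts' c' where "(\<lambda>x. qmonom ts c x * qmonom us d x) = qmonom ts' c'"
      using qmonom_mult by blast
    then have "(\<lambda>x. qmonom ts c x * qmonom us d x) \<in> qpoly_funs" by (simp add: qmonom_in)
    from qpoly_funs_add[OF this add(2)] show ?case by (simp add: distrib_left)
  qed
  from assms(1) show ?thesis
  proof (induction f rule: qpoly_funs_induct)
    case zero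
    then show ?case by (simp add: qpoly_funs_zero)
  next
    case (add us d f)
    from qpoly_funs_add[OF mono add(2)] show ?case by (simp add: distrib_right)
  qed
qed

lemma ring_qpoly_ring: "ring qpoly_ring"
proof (rule ringI, goal_cases)
  case 1
  show "abelian_group qpoly_ring"
  proof (rule abelian_groupI)
    fix f assume f: "f \<in> carrier qpoly_ring"
    have "(\<lambda>x. - 1 * f x) \<in> qpoly_funs"
      using f by (intro qpoly_funs_mult qpoly_funs_const) simp
    then show "\<exists>g\<in>carrier qpoly_ring. g \<oplus>\<^bsub>qpoly_ring\<^esub> f = \<zero>\<^bsub>qpoly_ring\<^esub>"
      by (intro bexI[of _ "\<lambda>x. - 1 * f x"]) auto
  qed (auto simp: qpoly_funs_add qpoly_funs_zero add_ac)
next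
  case 2
  show "monoid qpoly_ring"
    by (rule monoidI) (auto simp: qpoly_funs_mult qpoly_funs_const mult.assoc)
qed (auto simp: algebra_simps)

lemma qcnj_simps:
  "qcnj 0 = 0" "qcnj (p + q) = qcnj p + qcnj q" "qcnj (p * q) = qcnj q * qcnj p"
  by (simp_all add: qcnj_def zero_quat_def plus_quat_def times_quat_def algebra_simps)

text \<open>Conjugation stays inside the ring because
  \<open>qcnj q = - (q + i q i + j q j + k q k) / 2\<close> is itself a polynomial function of \<open>q\<close>.\<close>

lemma fun_cnj_in:
  assumes "f \<in> carrier qpoly_ring"
  shows "fun_cnj f \<in> carrier qpoly_ring"
proof -
  let ?h = "Quat (- 1 / 2) 0 0 0"
  let ?i = "Quat 0 1 0 0" and ?j = "Quat 0 0 1 0" and ?k = "Quat 0 0 0 1"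
  have "fun_cnj f = (\<lambda>x. ?h * (f x + ?i * f x * ?i + ?j * f x * ?j + ?k * f x * ?k))"
    by (simp add: fun_cnj_def fun_eq_iff qcnj_def times_quat_def plus_quat_def)
  moreover have "\<dots> \<in> qpoly_funs"
    using assms by (intro qpoly_funs_mult qpoly_funs_add qpoly_funs_const) simp_all
  ultimately show ?thesis by simp
qed

end

theory Submission
  imports Defs "HOL-Library.Function_Algebras" "HOL-Algebra.Ring_Divisibility"
begin

text \<open>
  Write \<open>N = f \<cdot> fun_cnj f\<close>. It is real-valued, hence central, and so are all sums of terms
  \<open>g \<cdot> fun_cnj g\<close>. Since norms are multiplicative, these sums form a semiring inside the centre,
  like the sums of squares in real algebra, and the argument follows the one for real radicals.

  If \<open>f\<close> lies in the radical of \<open>I\<close>, and \<open>P \<supseteq> I\<close> is prime and quaternionic, then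
  \<open>N\<^sup>m + s \<in> P\<close> for some \<open>m \<ge> 1\<close> and some sum of norms \<open>s\<close>. As \<open>N\<^sup>m\<close> is the norm of \<open>f\<^sup>m\<close>, the
  quaternionic property puts \<open>f\<^sup>m\<close>, and so \<open>N\<^sup>m\<close>, in \<open>P\<close>; primality yields \<open>N \<in> P\<close>, and the
  quaternionic property, used again, yields \<open>f \<in> P\<close>.

  Conversely, if \<open>f\<close> is not in the radical, then \<open>I\<close> avoids the multiplicatively closed set \<open>T\<close> of
  all \<open>N\<^sup>m + s\<close>, and Zorn's lemma provides an ideal \<open>P \<supseteq> I\<close> maximal among those that avoid \<open>T\<close>.
  It omits \<open>f\<close>, because \<open>N \<in> T\<close>. For a central \<open>a \<notin> P\<close> the ideal \<open>P + R a\<close> meets \<open>T\<close>.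
  Two elements of \<open>T\<close> found in this way can be multiplied, which shows that \<open>P\<close> is prime with respect to central
  elements; one of them can be squared, which shows that \<open>P\<close> is quaternionic
  (\<open>maximal_avoiding_prime\<close>, \<open>maximal_avoiding_quaternionic\<close>). The passage from arbitrary to central
  elements is \<open>central_component\<close>: an element outside \<open>P\<close> has one of its four real coordinate
  functions outside \<open>P\<close>, this coordinate lies in the ideal generated by the element, and its square
  differs from the norm of the element by another norm.
\<close>

section \<open>The ring of polynomial functions as a subring of a function space\<close>

text \<open>
  Functions are treated as elements of a ring. Inside an abstraction such as \<open>\<lambda>x. (f + g) x\<close>, which
  is \<open>f + g\<close> up to eta-conversion, the evaluation rules would let the simplifier take the ring
  operations apart; they are therefore used only where an identity is checked pointwise.
\<close>

lemmas fun_ring_apply =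
  plus_fun_apply times_fun_apply zero_fun_apply one_fun_apply fun_Compl_def fun_diff_def

declare plus_fun_apply [simp del] times_fun_apply [simp del]
  zero_fun_apply [simp del] one_fun_apply [simp del]

lemma qpoly_ring_pointwise:
  "f \<otimes>\<^bsub>qpoly_ring\<^esub> g = f * g"
  "f \<oplus>\<^bsub>qpoly_ring\<^esub> g = f + g"
  "\<one>\<^bsub>qpoly_ring\<^esub> = 1"
  "\<zero>\<^bsub>qpoly_ring\<^esub> = 0"
  by (simp_all add: fun_eq_iff fun_ring_apply)

lemma qpoly_closed [simp, intro]:
  "0 \<in> qpoly_funs" "1 \<in> qpoly_funs" "(\<lambda>_. c) \<in> qpoly_funs"
  "f \<in> qpoly_funs \<Longrightarrow> g \<in> qpoly_funs \<Longrightarrow> f + g \<in> qpoly_funs"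
  "f \<in> qpoly_funs \<Longrightarrow> g \<in> qpoly_funs \<Longrightarrow> f * g \<in> qpoly_funs"
  "f \<in> qpoly_funs \<Longrightarrow> fun_cnj f \<in> qpoly_funs"
  using qpoly_funs_const[of 0] qpoly_funs_const[of 1] qpoly_funs_const qpoly_funs_add[of f g]
    qpoly_funs_mult[of f g] fun_cnj_in[of f]
  by (simp_all add: zero_fun_def one_fun_def plus_fun_def times_fun_def)

lemma qpoly_minus [simp, intro]:
  assumes "f \<in> qpoly_funs" shows "- f \<in> qpoly_funs"
proof -
  have "- f = (\<lambda>_. - 1) * f" by (simp add: fun_eq_iff fun_ring_apply)
  then show ?thesis using assms by simp
qed

lemma qpoly_diff [simp, intro]:
  "f \<in> qpoly_funs \<Longrightarrow> g \<in> qpoly_funs \<Longrightarrow> f - g \<in> qpoly_funs"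
  using qpoly_closed(4)[of f "- g"] by simp

lemma qpoly_power [simp, intro]: "f \<in> qpoly_funs \<Longrightarrow> f ^ m \<in> qpoly_funs"
  by (induction m) auto

lemma qpoly_ring_pow: "f [^]\<^bsub>qpoly_ring\<^esub> (m::nat) = f ^ m"
proof -
  interpret ring qpoly_ring by (rule ring_qpoly_ring)
  show ?thesis
    by (induction m) (simp_all only: nat_pow_0 nat_pow_Suc qpoly_ring_pointwise power_0 power_Suc2)
qed

lemma qpoly_ring_finsum:
  assumes "finite A" and "g \<in> A \<rightarrow> qpoly_funs"
  shows "(\<Oplus>\<^bsub>qpoly_ring\<^esub>i\<in>A. g i) = (\<Sum>i\<in>A. g i)"
proof -
  interpret ring qpoly_ring by (rule ring_qpoly_ring)
  show ?thesis
    using assms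
  proof (induction A rule: finite_induct)
    case empty
    then show ?case by (simp only: finsum_empty qpoly_ring_pointwise sum.empty)
  next
    case (insert a A)
    then have "(\<Oplus>\<^bsub>qpoly_ring\<^esub>i\<in>insert a A. g i) = g a \<oplus>\<^bsub>qpoly_ring\<^esub> (\<Oplus>\<^bsub>qpoly_ring\<^esub>i\<in>A. g i)"
      by (intro finsum_insert) auto
    with insert show ?case
      by (simp add: qpoly_ring_pointwise Pi_iff del: qpoly_ring_simps(3))
  qed
qed

lemma ideal_closed:
  assumes "ideal P qpoly_ring"
  shows "P \<subseteq> qpoly_funs" "0 \<in> P"
    "a \<in> P \<Longrightarrow> b \<in> P \<Longrightarrow> a + b \<in> P"
    "a \<in> P \<Longrightarrow> r \<in> qpoly_funs \<Longrightarrow> r * a \<in> P"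
    "a \<in> P \<Longrightarrow> r \<in> qpoly_funs \<Longrightarrow> a * r \<in> P"
proof -
  interpret ideal P qpoly_ring by fact
  show "P \<subseteq> qpoly_funs" using a_subset by simp
  show "0 \<in> P"
    using additive_subgroup.zero_closed[OF is_additive_subgroup] by (simp only: qpoly_ring_pointwise)
  show "a \<in> P \<Longrightarrow> b \<in> P \<Longrightarrow> a + b \<in> P"
    using additive_subgroup.a_closed[OF is_additive_subgroup, of a b]
    by (simp only: qpoly_ring_pointwise)
  show "a \<in> P \<Longrightarrow> r \<in> qpoly_funs \<Longrightarrow> r * a \<in> P"
    using I_l_closed[of a r] by (simp only: qpoly_ring_pointwise qpoly_ring_simps(1))
  show "a \<in> P \<Longrightarrow> r \<in> qpoly_funs \<Longrightarrow> a * r \<in> P"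
    using I_r_closed[of a r] by (simp only: qpoly_ring_pointwise qpoly_ring_simps(1))
qed

lemma ideal_qpoly_ringI:
  assumes sub: "P \<subseteq> qpoly_funs" and zero: "0 \<in> P"
    and add: "\<And>a b. a \<in> P \<Longrightarrow> b \<in> P \<Longrightarrow> a + b \<in> P"
    and left: "\<And>a r. a \<in> P \<Longrightarrow> r \<in> qpoly_funs \<Longrightarrow> r * a \<in> P"
    and right: "\<And>a r. a \<in> P \<Longrightarrow> r \<in> qpoly_funs \<Longrightarrow> a * r \<in> P"
  shows "ideal P qpoly_ring"
proof -
  interpret ring qpoly_ring by (rule ring_qpoly_ring)
  have inv: "\<ominus>\<^bsub>qpoly_ring\<^esub> a \<in> P" if "a \<in> P" for a
  proof -
    have neg: "- a \<in> P" using left[of a "- 1"] that by simp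
    moreover have "\<ominus>\<^bsub>qpoly_ring\<^esub> a = - a"
      using that neg sub
      by (intro minus_equality) (auto simp del: qpoly_ring_simps(3,5) simp: qpoly_ring_pointwise)
    ultimately show ?thesis by simp
  qed
  have "subgroup P (add_monoid qpoly_ring)"
  proof (rule add.subgroupI)
    show "P \<noteq> {}" using zero by auto
    show "a \<oplus>\<^bsub>qpoly_ring\<^esub> b \<in> P" if "a \<in> P" "b \<in> P" for a b
      using add[OF that] by (simp only: qpoly_ring_pointwise)
  qed (use sub inv in auto)
  then show ?thesis
    by (rule idealI[OF ring_qpoly_ring])
      (use left right in \<open>simp_all only: qpoly_ring_pointwise qpoly_ring_simps(1)\<close>)
qed

lemma sum_in_ideal:
  assumes "ideal P qpoly_ring" "finite A" "\<And>u. u \<in> A \<Longrightarrow> g u \<in> P"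
  shows "sum g A \<in> P"
  using assms(2,3) by (induction A rule: finite_induct) (simp_all add: ideal_closed[OF assms(1)])

text \<open>
  Two-sided ideals are stable under conjugation, because conjugation is a real combination of the
  maps \<open>q \<mapsto> u q u\<close> for the units \<open>u = 1, i, j, k\<close>.
\<close>

lemma ideal_fun_cnj:
  assumes P: "ideal P qpoly_ring" and "f \<in> P"
  shows "fun_cnj f \<in> P"
proof -
  let ?i = "\<lambda>_. Quat 0 1 0 0" and ?j = "\<lambda>_. Quat 0 0 1 0" and ?k = "\<lambda>_. Quat 0 0 0 1"
  have "fun_cnj f = (\<lambda>_. Quat (- 1 / 2) 0 0 0) *
      (f + ?i * f * ?i + ?j * f * ?j + ?k * f * ?k)"
    by (simp add: fun_cnj_def fun_eq_iff fun_ring_apply qcnj_def times_quat_def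
        plus_quat_def)
  also have "\<dots> \<in> P"
    using assms(2) by (intro ideal_closed(3-5)[OF P] qpoly_closed(3))
  finally show ?thesis .
qed

section \<open>Self-conjugate elements and real coordinates\<close>

lemma fun_cnj_simps [simp]:
  "fun_cnj 0 = 0" "fun_cnj 1 = 1" "fun_cnj (fun_cnj f) = f"
  "fun_cnj (f + g) = fun_cnj f + fun_cnj g" "fun_cnj (f * g) = fun_cnj g * fun_cnj f"
  by (simp_all add: fun_cnj_def fun_eq_iff fun_ring_apply qcnj_simps)
    (simp_all add: qcnj_def one_quat_def)

text \<open>The self-conjugate functions are the real-valued ones.\<close>

lemma self_conjugate_central:
  assumes "fun_cnj a = a"
  shows "a * g = g * a"
proof
  fix x
  have "qcnj (a x) = a x" using assms by (simp add: fun_cnj_def fun_eq_iff fun_ring_apply)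
  then show "(a * g) x = (g * a) x"
    by (cases "a x") (simp add: fun_ring_apply qcnj_def times_quat_def algebra_simps)
qed

text \<open>The pointwise square of the absolute value.\<close>

abbreviation norm_fun :: "('a \<Rightarrow> quat) \<Rightarrow> 'a \<Rightarrow> quat" where
  "norm_fun f \<equiv> f * fun_cnj f"

lemma norm_fun_commute: "norm_fun f * g = g * norm_fun f"
  by (rule self_conjugate_central) simp

text \<open>The inner factor of \<open>(f g) \<cdot> fun_cnj (f g) = f (g \<cdot> fun_cnj g) fun_cnj f\<close> is central.\<close>

lemma norm_fun_mult: "norm_fun f * norm_fun g = norm_fun (f * g)"
proof -
  have "norm_fun (f * g) = f * norm_fun g * fun_cnj f"
    by (simp add: mult.assoc)
  also have "\<dots> = norm_fun f * norm_fun g"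
    using norm_fun_commute[of g "fun_cnj f"] by (simp only: mult.assoc)
  finally show ?thesis ..
qed

lemma norm_fun_power: "norm_fun f ^ m = norm_fun (f ^ m)"
proof (induction m)
  case (Suc m)
  then show ?case by (simp only: power_Suc norm_fun_mult)
qed simp

definition re_fun :: "('a \<Rightarrow> quat) \<Rightarrow> 'a \<Rightarrow> quat" where
  "re_fun f = (\<lambda>x. Quat (qRe (f x)) 0 0 0)"

lemma re_fun_conv: "re_fun f = (\<lambda>_. Quat (1 / 2) 0 0 0) * (f + fun_cnj f)"
  by (simp add: re_fun_def fun_cnj_def fun_eq_iff fun_ring_apply qcnj_def times_quat_def plus_quat_def)

lemma re_fun_self_conjugate: "fun_cnj (re_fun f) = re_fun f"
  by (simp add: re_fun_def fun_cnj_def fun_eq_iff fun_ring_apply qcnj_def)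

text \<open>
  The four real coordinates of \<open>f\<close> are, up to sign, the real parts of \<open>u f\<close> for the units
  \<open>u = 1, i, j, k\<close>, and \<open>f\<close> is a combination of them; so \<open>f \<notin> P\<close> forces one of them out of \<open>P\<close>.
  The element \<open>g\<close> is the imaginary part of \<open>u f\<close>; since \<open>u\<close> is a unit quaternion, \<open>u f\<close> has the
  same norm as \<open>f\<close>.
\<close>

lemma central_component:
  assumes P: "ideal P qpoly_ring" and f: "f \<in> qpoly_funs" "f \<notin> P"
  obtains a g where "a \<in> qpoly_funs" "fun_cnj a = a" "a \<notin> P" "g \<in> qpoly_funs"
    "norm_fun f = a * a + norm_fun g" "\<And>Q. ideal Q qpoly_ring \<Longrightarrow> f \<in> Q \<Longrightarrow> a \<in> Q"
proof -
  let ?U = "{Quat 1 0 0 0, Quat 0 1 0 0, Quat 0 0 1 0, Quat 0 0 0 1}"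
  let ?c = "\<lambda>u. (\<lambda>_. qcnj u) * re_fun ((\<lambda>_. u) * f)"
  have f_eq: "f = (\<Sum>u\<in>?U. ?c u)"
  proof
    fix x
    show "f x = (\<Sum>u\<in>?U. ?c u) x"
      by (cases "f x")
        (simp add: re_fun_def fun_ring_apply qcnj_def times_quat_def plus_quat_def)
  qed
  have "\<exists>u\<in>?U. re_fun ((\<lambda>_. u) * f) \<notin> P"
  proof (rule ccontr)
    assume "\<not> ?thesis"
    then have "?c u \<in> P" if "u \<in> ?U" for u
      using that by (intro ideal_closed(4)[OF P] qpoly_closed(3)) blast
    then have "(\<Sum>u\<in>?U. ?c u) \<in> P"
      by (intro sum_in_ideal[OF P]) auto
    then have "f \<in> P" by (subst f_eq)
    then show False using f(2) by simp
  qed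
  then obtain u where u: "u \<in> ?U" "re_fun ((\<lambda>_. u) * f) \<notin> P" by blast
  define h where "h = (\<lambda>_. u) * f"
  have h: "h \<in> qpoly_funs" unfolding h_def using f(1) by simp
  have re_in: "re_fun h \<in> Q" if Q: "ideal Q qpoly_ring" "f \<in> Q" for Q
  proof -
    have "h \<in> Q" unfolding h_def using Q by (intro ideal_closed(4)) auto
    then show ?thesis
      unfolding re_fun_conv using Q(1) by (intro ideal_closed(3,4) ideal_fun_cnj) auto
  qed
  have re_carrier: "re_fun h \<in> qpoly_funs"
    unfolding re_fun_conv using h by simp
  have norm: "norm_fun f = re_fun h * re_fun h + norm_fun (h - re_fun h)"
  proof
    fix x
    show "norm_fun f x = (re_fun h * re_fun h + norm_fun (h - re_fun h)) x"
      using u(1)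
      by (cases "f x") (auto simp: h_def re_fun_def fun_cnj_def fun_ring_apply qcnj_def
          times_quat_def plus_quat_def minus_quat_def algebra_simps)
  qed
  show thesis
    by (rule that[OF re_carrier re_fun_self_conjugate _ _ norm re_in])
      (use u(2) h re_carrier in \<open>simp_all add: h_def qpoly_diff\<close>)
qed

section \<open>Sums of norms\<close>

text \<open>
  An inductive set instead of sums over an index set: closure under addition and multiplication
  then follows by rule induction, without reindexing.
\<close>

inductive_set sums_of_norms :: "(quat ^ 'n::finite \<Rightarrow> quat) set" where
  zero: "0 \<in> sums_of_norms"
| norm_add: "g \<in> qpoly_funs \<Longrightarrow> s \<in> sums_of_norms \<Longrightarrow> norm_fun g + s \<in> sums_of_norms"

lemma norm_in_sums_of_norms: "g \<in> qpoly_funs \<Longrightarrow> norm_fun g \<in> sums_of_norms"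
  using sums_of_norms.norm_add[OF _ sums_of_norms.zero] by simp

lemma sums_of_norms_carrier: "s \<in> sums_of_norms \<Longrightarrow> s \<in> qpoly_funs"
  by (induction rule: sums_of_norms.induct) auto

lemma sums_of_norms_self_conjugate: "s \<in> sums_of_norms \<Longrightarrow> fun_cnj s = s"
  by (induction rule: sums_of_norms.induct) auto

lemma sums_of_norms_add:
  "s \<in> sums_of_norms \<Longrightarrow> t \<in> sums_of_norms \<Longrightarrow> s + t \<in> sums_of_norms"
  by (induction rule: sums_of_norms.induct) (auto simp: add.assoc intro: sums_of_norms.norm_add)

lemma sums_of_norms_mult_norm:
  assumes "s \<in> sums_of_norms" and g: "g \<in> qpoly_funs"
  shows "norm_fun g * s \<in> sums_of_norms"
  using assms(1)
proof (induction rule: sums_of_norms.induct)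
  case zero
  then show ?case by (simp add: sums_of_norms.zero)
next
  case (norm_add h s)
  then have "norm_fun (g * h) + norm_fun g * s \<in> sums_of_norms"
    using g by (intro sums_of_norms.norm_add) auto
  then show ?case by (simp only: distrib_left norm_fun_mult)
qed

lemma sums_of_norms_mult:
  assumes "s \<in> sums_of_norms" "t \<in> sums_of_norms"
  shows "s * t \<in> sums_of_norms"
  using assms(1)
proof (induction rule: sums_of_norms.induct)
  case zero
  then show ?case by (simp add: sums_of_norms.zero)
next
  case (norm_add h s)
  then show ?case
    by (simp only: distrib_right sums_of_norms_add sums_of_norms_mult_norm assms(2))
qed

lemma sum_norm_in_sums_of_norms:
  assumes "finite A" "g \<in> A \<rightarrow> qpoly_funs"
  shows "(\<Sum>i\<in>A. norm_fun (g i)) \<in> sums_of_norms"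
  using assms
  by (induction A rule: finite_induct) (auto intro: sums_of_norms.intros simp: Pi_iff)

lemma sums_of_norms_indexed:
  assumes "s \<in> sums_of_norms"
  obtains k :: nat and g where "g \<in> {..<k} \<rightarrow> qpoly_funs" "s = (\<Sum>i<k. norm_fun (g i))"
proof -
  have "\<exists>(k::nat) g. g \<in> {..<k} \<rightarrow> qpoly_funs \<and> s = (\<Sum>i<k. norm_fun (g i))"
    using assms
  proof (induction rule: sums_of_norms.induct)
    case zero
    show ?case by (intro exI[of _ 0]) auto
  next
    case (norm_add h s)
    then obtain k :: nat and g where "g \<in> {..<k} \<rightarrow> qpoly_funs" "s = (\<Sum>i<k. norm_fun (g i))"
      by blast
    with norm_add.hyps(1) show ?case
      by (intro exI[of _ "Suc k"] exI[of _ "g(k := h)"]) (auto simp: Pi_iff add.commute)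
  qed
  then show thesis using that by blast
qed

lemma qpoly_ring_finsum_norm:
  assumes "g \<in> {..<k::nat} \<rightarrow> qpoly_funs"
  shows "(\<Oplus>\<^bsub>qpoly_ring\<^esub>i\<in>{..<k}. g i \<otimes>\<^bsub>qpoly_ring\<^esub> fun_cnj (g i)) = (\<Sum>i<k. norm_fun (g i))"
  unfolding qpoly_ring_pointwise using assms by (intro qpoly_ring_finsum) (auto simp: Pi_iff)

lemma quaternionic_ideal_sum_iff:
  "quaternionic_ideal P \<longleftrightarrow> ideal P qpoly_ring \<and>
    (\<forall>(k::nat) g. g \<in> {..<k} \<rightarrow> qpoly_funs \<longrightarrow> (\<Sum>i<k. norm_fun (g i)) \<in> P \<longrightarrow> (\<forall>i<k. g i \<in> P))"
  unfolding quaternionic_ideal_def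
  by (simp only: qpoly_ring_finsum_norm qpoly_ring_simps(1) cong: imp_cong)

text \<open>
  The elements of a sum of norms are interchangeable, so it is enough to extract a single one and
  to collect the others in \<open>s\<close>.
\<close>

lemma quaternionic_ideal_iff:
  "quaternionic_ideal P \<longleftrightarrow> ideal P qpoly_ring \<and>
    (\<forall>f\<in>qpoly_funs. \<forall>s\<in>sums_of_norms. norm_fun f + s \<in> P \<longrightarrow> f \<in> P)"
  (is "?L \<longleftrightarrow> ?R")
proof
  assume L: ?L
  have "f \<in> P" if f: "f \<in> qpoly_funs" and s: "s \<in> sums_of_norms" and "norm_fun f + s \<in> P" for f s
  proof -
    obtain k :: nat and g where g: "g \<in> {..<k} \<rightarrow> qpoly_funs" "s = (\<Sum>i<k. norm_fun (g i))"
      using sums_of_norms_indexed[OF s] .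
    let ?g = "g(k := f)"
    have g': "?g \<in> {..<Suc k} \<rightarrow> qpoly_funs" using f g(1) by (auto simp: Pi_iff)
    have "(\<Sum>i<Suc k. norm_fun (?g i)) \<in> P"
      using that(3) g(2) by (simp add: add.commute)
    then have "?g k \<in> P"
      using L g' lessI[of k] unfolding quaternionic_ideal_sum_iff by blast
    then show ?thesis by simp
  qed
  with L show ?R by (auto simp: quaternionic_ideal_def)
next
  assume R: ?R
  have "g i \<in> P" if g: "g \<in> {..<k} \<rightarrow> qpoly_funs" and sum: "(\<Sum>i<k. norm_fun (g i)) \<in> P"
    and i: "i < k" for k i :: nat and g
  proof -
    have "(\<Sum>i<k. norm_fun (g i)) = norm_fun (g i) + (\<Sum>j\<in>{..<k} - {i}. norm_fun (g j))"
      using i by (intro sum.remove) auto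
    moreover have "(\<Sum>j\<in>{..<k} - {i}. norm_fun (g j)) \<in> sums_of_norms"
      using g by (intro sum_norm_in_sums_of_norms) auto
    ultimately show ?thesis using R sum g i by (auto simp: Pi_iff)
  qed
  with R show ?L
    unfolding quaternionic_ideal_sum_iff by blast
qed

text \<open>
  An element \<open>f\<close> of the ring belongs to the radical of \<open>I\<close> exactly if \<open>I\<close> meets this set, the \<open>T\<close> of
  the introduction. It is stable under products and under addition of sums of norms.
\<close>

definition radical_witnesses :: "(quat ^ 'n::finite \<Rightarrow> quat) \<Rightarrow> (quat ^ 'n \<Rightarrow> quat) set" where
  "radical_witnesses f = {norm_fun f ^ m + s | m s. m \<ge> 1 \<and> s \<in> sums_of_norms}"

lemma quaternionic_radical_iff:
  "f \<in> quaternionic_radical I \<longleftrightarrow> f \<in> qpoly_funs \<and> I \<inter> radical_witnesses f \<noteq> {}"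
proof
  assume "f \<in> quaternionic_radical I"
  then obtain m k :: nat and g where f: "f \<in> qpoly_funs" and m: "m \<ge> 1"
    and g: "g \<in> {..<k} \<rightarrow> qpoly_funs"
    and I: "norm_fun f [^]\<^bsub>qpoly_ring\<^esub> m \<oplus>\<^bsub>qpoly_ring\<^esub>
      (\<Oplus>\<^bsub>qpoly_ring\<^esub>i\<in>{..<k}. g i \<otimes>\<^bsub>qpoly_ring\<^esub> fun_cnj (g i)) \<in> I"
    unfolding quaternionic_radical_def qpoly_ring_pointwise(1) qpoly_ring_simps(1) by blast
  have "norm_fun f ^ m + (\<Sum>i<k. norm_fun (g i)) \<in> I"
    using I unfolding qpoly_ring_finsum_norm[OF g] qpoly_ring_pow qpoly_ring_pointwise(2) .
  moreover have "(\<Sum>i<k. norm_fun (g i)) \<in> sums_of_norms"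
    using g by (intro sum_norm_in_sums_of_norms) auto
  ultimately show "f \<in> qpoly_funs \<and> I \<inter> radical_witnesses f \<noteq> {}"
    using f m unfolding radical_witnesses_def by blast
next
  assume "f \<in> qpoly_funs \<and> I \<inter> radical_witnesses f \<noteq> {}"
  then obtain m s where f: "f \<in> qpoly_funs" and m: "m \<ge> 1" and s: "s \<in> sums_of_norms"
    and I: "norm_fun f ^ m + s \<in> I"
    unfolding radical_witnesses_def by blast
  obtain k :: nat and g where g: "g \<in> {..<k} \<rightarrow> qpoly_funs" "s = (\<Sum>i<k. norm_fun (g i))"
    using sums_of_norms_indexed[OF s] .
  have "norm_fun f [^]\<^bsub>qpoly_ring\<^esub> m \<oplus>\<^bsub>qpoly_ring\<^esub>
      (\<Oplus>\<^bsub>qpoly_ring\<^esub>i\<in>{..<k}. g i \<otimes>\<^bsub>qpoly_ring\<^esub> fun_cnj (g i)) \<in> I"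
    unfolding qpoly_ring_finsum_norm[OF g(1)] qpoly_ring_pow qpoly_ring_pointwise(2)
    using I g(2) by simp
  with f m g(1) show "f \<in> quaternionic_radical I"
    unfolding quaternionic_radical_def qpoly_ring_pointwise(1) qpoly_ring_simps(1) by blast
qed

lemma norm_in_radical_witnesses: "norm_fun f \<in> radical_witnesses f"
  unfolding radical_witnesses_def
  by (intro CollectI exI[of _ 1] exI[of _ 0]) (simp add: sums_of_norms.zero)

lemma radical_witnesses_sums_of_norms:
  assumes "f \<in> qpoly_funs" "t \<in> radical_witnesses f"
  shows "t \<in> sums_of_norms"
proof -
  obtain m s where "t = norm_fun (f ^ m) + s" "s \<in> sums_of_norms"
    using assms(2) by (auto simp: radical_witnesses_def norm_fun_power)
  then show ?thesis using assms(1) sums_of_norms.norm_add[of "f ^ m" s] by auto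
qed

lemma radical_witnesses_add:
  assumes "t \<in> radical_witnesses f" "s \<in> sums_of_norms"
  shows "t + s \<in> radical_witnesses f"
proof -
  obtain m r where "t = norm_fun f ^ m + r" "m \<ge> 1" "r \<in> sums_of_norms"
    using assms(1) by (auto simp: radical_witnesses_def)
  then have "t + s = norm_fun f ^ m + (r + s)" "m \<ge> 1" "r + s \<in> sums_of_norms"
    using assms(2) by (auto simp: add.assoc sums_of_norms_add)
  then show ?thesis unfolding radical_witnesses_def by blast
qed

lemma radical_witnesses_mult:
  assumes f: "f \<in> qpoly_funs" and t: "t \<in> radical_witnesses f" and t': "t' \<in> radical_witnesses f"
  shows "t * t' \<in> radical_witnesses f"
proof -
  obtain m s where m: "t = norm_fun f ^ m + s" "m \<ge> 1" "s \<in> sums_of_norms"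
    using t by (auto simp: radical_witnesses_def)
  obtain m' s' where m': "t' = norm_fun f ^ m' + s'" "m' \<ge> 1" "s' \<in> sums_of_norms"
    using t' by (auto simp: radical_witnesses_def)
  have pow: "norm_fun f ^ l \<in> sums_of_norms" for l
    using f by (simp only: norm_fun_power norm_in_sums_of_norms qpoly_power)
  have "t * t' = norm_fun f ^ (m + m') + (norm_fun f ^ m * s' + s * norm_fun f ^ m' + s * s')"
    unfolding m m' power_add distrib_left distrib_right by (simp only: add_ac)
  moreover have "norm_fun f ^ m * s' + s * norm_fun f ^ m' + s * s' \<in> sums_of_norms"
    by (intro sums_of_norms_add sums_of_norms_mult pow m m')
  moreover have "m + m' \<ge> 1" using m(2) by simp
  ultimately show ?thesis unfolding radical_witnesses_def by blast
qed

section \<open>Prime quaternionic ideals contain the radical\<close>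

text \<open>
  Centrality of \<open>a\<close> is what makes the annihilator of \<open>a\<close> modulo \<open>P\<close> a two-sided ideal; so \<open>a b \<in> P\<close>
  extends to the product of the ideals generated by \<open>a\<close> and \<open>b\<close>.
\<close>

lemma krull_prime_central:
  assumes prime: "krull_prime_ideal P qpoly_ring"
    and a: "a \<in> qpoly_funs" "fun_cnj a = a" and b: "b \<in> qpoly_funs" and ab: "a * b \<in> P"
  shows "a \<in> P \<or> b \<in> P"
proof -
  interpret ring qpoly_ring by (rule ring_qpoly_ring)
  have P: "ideal P qpoly_ring" using prime unfolding krull_prime_ideal_def by blast
  note Pc = ideal_closed[OF P]
  let ?A = "genideal qpoly_ring {a}" and ?B = "genideal qpoly_ring {b}"
  have gen: "ideal ?A qpoly_ring" "ideal ?B qpoly_ring" "a \<in> ?A" "b \<in> ?B"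
    by (rule genideal_ideal genideal_self'; use a(1) b in simp)+
  have "ideal {y \<in> qpoly_funs. a * y \<in> P} qpoly_ring"
  proof (rule ideal_qpoly_ringI)
    fix y r assume y: "y \<in> {y \<in> qpoly_funs. a * y \<in> P}"
      and r: "r \<in> (qpoly_funs :: (quat ^ 'a \<Rightarrow> quat) set)"
    have "a * (r * y) = r * (a * y)"
      by (simp only: mult.assoc[symmetric] self_conjugate_central[OF a(2), of r])
    then show "r * y \<in> {y \<in> qpoly_funs. a * y \<in> P}"
      using y r Pc(4)[of "a * y" r] by simp
    show "y * r \<in> {y \<in> qpoly_funs. a * y \<in> P}"
      using y r Pc(5)[of "a * y" r] by (simp add: mult.assoc)
  qed (simp_all add: distrib_left Pc(2,3) subset_iff)
  then have "?B \<subseteq> {y \<in> qpoly_funs. a * y \<in> P}"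
    by (rule genideal_minimal) (simp add: b ab)
  moreover have "ideal {x \<in> qpoly_funs. \<forall>y\<in>?B. x * y \<in> P} qpoly_ring"
    by (intro ideal_qpoly_ringI)
      (simp_all add: subset_iff distrib_right mult.assoc Pc(2-4) ideal_closed(4)[OF gen(2)])
  ultimately have "?A \<subseteq> {x \<in> qpoly_funs. \<forall>y\<in>?B. x * y \<in> P}"
    by (intro genideal_minimal) (use a(1) in blast)+
  then have mult: "x * y \<in> P" if "x \<in> ?A" "y \<in> ?B" for x y using that by blast
  have "z \<in> P" if "z \<in> ideal_prod qpoly_ring ?A ?B" for z
    using that
  proof (induction rule: ideal_prod.induct)
    case (prod x y)
    then show ?case unfolding qpoly_ring_pointwise by (rule mult)
  next
    case (sum x y)
    then show ?case unfolding qpoly_ring_pointwise by (intro Pc(3))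
  qed
  then have "ideal_prod qpoly_ring ?A ?B \<subseteq> P" by blast
  then have "?A \<subseteq> P \<or> ?B \<subseteq> P"
    using prime a(1) b unfolding krull_prime_ideal_def qpoly_ring_simps(1) by blast
  then show ?thesis using gen(3,4) by blast
qed

lemma krull_prime_central_power:
  assumes prime: "krull_prime_ideal P qpoly_ring" and a: "a \<in> qpoly_funs" "fun_cnj a = a"
    and "a ^ m \<in> P" "m \<ge> 1"
  shows "a \<in> P"
  using assms(5,4)
proof (induction m rule: dec_induct)
  case (step m)
  then show ?case using krull_prime_central[OF prime a, of "a ^ m"] a by auto
qed simp

lemma radical_subset_prime_quaternionic:
  assumes prime: "krull_prime_ideal P qpoly_ring" and quat: "quaternionic_ideal P"
    and "I \<subseteq> P" and f: "f \<in> quaternionic_radical I"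
  shows "f \<in> P"
proof -
  have fR: "f \<in> qpoly_funs" using f by (simp add: quaternionic_radical_iff)
  have P: "ideal P qpoly_ring" using quat by (simp add: quaternionic_ideal_def)
  obtain m s where m: "m \<ge> 1" "s \<in> sums_of_norms" "norm_fun f ^ m + s \<in> P"
    using f \<open>I \<subseteq> P\<close> by (auto simp: quaternionic_radical_iff radical_witnesses_def)
  (* norm_fun f ^ m is itself a norm, namely that of f ^ m. *)
  have "f ^ m \<in> P"
    using quat fR m unfolding quaternionic_ideal_iff norm_fun_power by auto
  then have "norm_fun f ^ m \<in> P"
    unfolding norm_fun_power using fR by (intro ideal_closed[OF P]) auto
  then have "norm_fun f \<in> P"
    using krull_prime_central_power[OF prime _ _ _ m(1), of "norm_fun f"] fR by auto
  then have "norm_fun f + 0 \<in> P" by simp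
  then show ?thesis
    using quat fR sums_of_norms.zero unfolding quaternionic_ideal_iff by blast
qed

section \<open>Ideals maximal among those avoiding the witnesses of the radical\<close>

definition maximal_avoiding :: "(quat ^ 'n::finite \<Rightarrow> quat) \<Rightarrow> (quat ^ 'n \<Rightarrow> quat) set \<Rightarrow> bool" where
  "maximal_avoiding f P \<longleftrightarrow> ideal P qpoly_ring \<and> P \<inter> radical_witnesses f = {} \<and>
    (\<forall>Q. ideal Q qpoly_ring \<longrightarrow> Q \<inter> radical_witnesses f = {} \<longrightarrow> P \<subseteq> Q \<longrightarrow> Q = P)"

lemma maximal_avoidingD:
  assumes "maximal_avoiding f P" "ideal Q qpoly_ring" "P \<subseteq> Q" "Q \<inter> radical_witnesses f = {}"
  shows "Q = P"
  using assms unfolding maximal_avoiding_def by simp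

lemma exists_maximal_avoiding:
  assumes I: "ideal I qpoly_ring" "I \<inter> radical_witnesses f = {}"
  obtains P where "maximal_avoiding f P" "I \<subseteq> P"
proof -
  interpret ring qpoly_ring by (rule ring_qpoly_ring)
  let ?F = "{Q. ideal Q qpoly_ring \<and> Q \<inter> radical_witnesses f = {} \<and> I \<subseteq> Q}"
  have "\<exists>P\<in>?F. \<forall>Q\<in>?F. P \<subseteq> Q \<longrightarrow> Q = P"
  proof (rule subset_Zorn_nonempty)
    show "?F \<noteq> {}" using I by blast
    fix C assume C: "C \<noteq> {}" "subset.chain ?F C"
    have sub: "C \<subseteq> ?F"
      using C(2) unfolding pred_on.chain_def by (rule conjunct1)
    then have "C \<subseteq> {Q. ideal Q qpoly_ring}" by blast
    then have "subset.chain {Q. ideal Q qpoly_ring} C"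
      using C(2) unfolding pred_on.chain_def by (rule conjI[OF _ conjunct2])
    from chain_Union_is_ideal[OF this] have "ideal (\<Union>C) qpoly_ring"
      by (simp only: C(1) if_False)
    moreover have "\<Union>C \<inter> radical_witnesses f = {}" "I \<subseteq> \<Union>C"
      using sub C(1) by blast+
    ultimately show "\<Union>C \<in> ?F" by simp
  qed
  then obtain P where PF: "P \<in> ?F" and max: "\<forall>Q\<in>?F. P \<subseteq> Q \<longrightarrow> Q = P" by (rule bexE)
  from PF have P: "ideal P qpoly_ring" "P \<inter> radical_witnesses f = {}" "I \<subseteq> P" by simp_all
  have "Q = P" if "ideal Q qpoly_ring" "Q \<inter> radical_witnesses f = {}" "P \<subseteq> Q" for Q
    using max that order_trans[OF P(3) that(3)] by simp
  with P have "maximal_avoiding f P" unfolding maximal_avoiding_def by blast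
  then show thesis using P(3) by (rule that)
qed

text \<open>For a central \<open>a\<close> the left multiples of \<open>a\<close> are already closed under multiplication from the right.\<close>

lemma ideal_adjoin_central:
  assumes P: "ideal P qpoly_ring" and a: "a \<in> qpoly_funs" "fun_cnj a = a"
  shows "ideal {p + h * a | p h. p \<in> P \<and> h \<in> qpoly_funs} qpoly_ring" (is "ideal ?Q _")
proof (rule ideal_qpoly_ringI)
  note Pc = ideal_closed[OF P]
  show "?Q \<subseteq> qpoly_funs" using Pc(1) a by auto
  show "0 \<in> ?Q" using Pc(2) by (intro CollectI exI[of _ 0]) simp
  show "x + y \<in> ?Q" if xy: "x \<in> ?Q" "y \<in> ?Q" for x y
  proof -
    obtain p h where "x = p + h * a" "p \<in> P" "h \<in> qpoly_funs" using xy(1) by blast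
    moreover obtain q k where "y = q + k * a" "q \<in> P" "k \<in> qpoly_funs" using xy(2) by blast
    ultimately show ?thesis
      using Pc(3) by (intro CollectI exI[of _ "p + q"] exI[of _ "h + k"]) (simp add: distrib_right add_ac)
  qed
  fix x r assume "x \<in> ?Q" and r: "r \<in> (qpoly_funs :: (quat ^ 'a \<Rightarrow> quat) set)"
  then obtain p h where x: "x = p + h * a" "p \<in> P" "h \<in> qpoly_funs" by blast
  show "r * x \<in> ?Q"
    using x r Pc(4) by (intro CollectI exI[of _ "r * p"] exI[of _ "r * h"]) (simp add: distrib_left mult.assoc)
  have "x * r = p * r + h * r * a"
    unfolding x(1) distrib_right mult.assoc self_conjugate_central[OF a(2), of r] ..
  then show "x * r \<in> ?Q"
    using x r Pc(5) by (intro CollectI exI[of _ "p * r"] exI[of _ "h * r"]) simp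
qed

lemma maximal_avoiding_central:
  assumes max: "maximal_avoiding f P" and a: "a \<in> qpoly_funs" "fun_cnj a = a" "a \<notin> P"
  obtains t h where "t \<in> radical_witnesses f" "h \<in> qpoly_funs" "t - h * a \<in> P"
proof -
  have P: "ideal P qpoly_ring" using max by (simp add: maximal_avoiding_def)
  let ?Q = "{p + h * a | p h. p \<in> P \<and> h \<in> qpoly_funs}"
  have "P \<subseteq> ?Q"
  proof
    fix p assume "p \<in> P"
    then show "p \<in> ?Q" by (intro CollectI exI[of _ p] exI[of _ 0]) simp
  qed
  have "a \<in> ?Q"
    using ideal_closed(2)[OF P] by (intro CollectI exI[of _ 0] exI[of _ 1]) simp
  have "?Q \<inter> radical_witnesses f \<noteq> {}"
  proof
    assume "?Q \<inter> radical_witnesses f = {}"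
    with \<open>P \<subseteq> ?Q\<close> have "?Q = P"
      by (rule maximal_avoidingD[OF max ideal_adjoin_central[OF P a(1,2)]])
    then show False using \<open>a \<in> ?Q\<close> a(3) by (simp only:)
  qed
  then obtain p h where "p + h * a \<in> radical_witnesses f" "p \<in> P" "h \<in> qpoly_funs" by blast
  then show thesis using that[of "p + h * a" h] by simp
qed

text \<open>
  If \<open>t \<equiv> h a\<close> and \<open>t' \<equiv> h' b\<close> modulo \<open>P\<close> with \<open>a\<close>, \<open>b\<close> central and \<open>a b \<in> P\<close>, then
  \<open>t t' \<equiv> h h' a b \<equiv> 0\<close>, although \<open>t t'\<close> is again a witness.
\<close>

lemma maximal_avoiding_prime:
  assumes max: "maximal_avoiding f P" and f: "f \<in> qpoly_funs"
  shows "krull_prime_ideal P qpoly_ring"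
proof -
  interpret ring qpoly_ring by (rule ring_qpoly_ring)
  have P: "ideal P qpoly_ring" and avoid: "P \<inter> radical_witnesses f = {}"
    using max by (simp_all add: maximal_avoiding_def)
  note Pc = ideal_closed[OF P]
  have "x \<in> P \<or> y \<in> P"
    if x: "x \<in> qpoly_funs" and y: "y \<in> qpoly_funs"
      and prod: "ideal_prod qpoly_ring (genideal qpoly_ring {x}) (genideal qpoly_ring {y}) \<subseteq> P"
    for x y
  proof (rule ccontr)
    assume "\<not> (x \<in> P \<or> y \<in> P)"
    then obtain a g where a: "a \<in> qpoly_funs" "fun_cnj a = a" "a \<notin> P"
        "\<And>Q. ideal Q qpoly_ring \<Longrightarrow> x \<in> Q \<Longrightarrow> a \<in> Q"
      using central_component[OF P x] by metis
    from \<open>\<not> (x \<in> P \<or> y \<in> P)\<close> obtain b g' where b: "b \<in> qpoly_funs" "fun_cnj b = b" "b \<notin> P"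
        "\<And>Q. ideal Q qpoly_ring \<Longrightarrow> y \<in> Q \<Longrightarrow> b \<in> Q"
      using central_component[OF P y] by metis
    have "a \<in> genideal qpoly_ring {x}" "b \<in> genideal qpoly_ring {y}"
      using x y by (auto intro!: a(4) b(4) genideal_ideal genideal_self')
    from ideal_prod.prod[OF this, of qpoly_ring] prod have ab: "a * b \<in> P"
      unfolding qpoly_ring_pointwise by blast
    obtain t h where t: "t \<in> radical_witnesses f" "h \<in> qpoly_funs" "t - h * a \<in> P"
      using maximal_avoiding_central[OF max a(1-3)] .
    obtain t' h' where t': "t' \<in> radical_witnesses f" "h' \<in> qpoly_funs" "t' - h' * b \<in> P"
      using maximal_avoiding_central[OF max b(1-3)] .
    have t'R: "t' \<in> qpoly_funs"
      using radical_witnesses_sums_of_norms[OF f t'(1)] by (rule sums_of_norms_carrier)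
    have "h * a * (h' * b) = h * h' * (a * b)"
      using self_conjugate_central[OF a(2), of h'] by (metis mult.assoc)
    then have "t * t' = (t - h * a) * t' + h * a * (t' - h' * b) + h * h' * (a * b)"
      by (simp add: algebra_simps)
    also have "\<dots> \<in> P"
      by (intro Pc(3) Pc(4)[OF ab] Pc(4)[OF t'(3)] Pc(5)[OF t(3)]) (use t t' t'R a(1) in auto)
    finally show False
      using radical_witnesses_mult[OF f t(1) t'(1)] avoid by auto
  qed
  moreover have "genideal qpoly_ring {x} \<subseteq> P" if "x \<in> P" for x
    using P that by (intro genideal_minimal) auto
  ultimately show ?thesis using P unfolding krull_prime_ideal_def by auto
qed

text \<open>
  Suppose that \<open>norm_fun g + s \<in> P\<close> and \<open>g \<notin> P\<close>. A real coordinate \<open>a\<close> of \<open>g\<close> outside \<open>P\<close> has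
  \<open>a\<^sup>2 + s' \<in> P\<close> for another sum of norms \<open>s'\<close>. From \<open>t \<equiv> h a\<close> modulo \<open>P\<close> for a witness \<open>t\<close>, which is
  its own conjugate, follows \<open>t\<^sup>2 \<equiv> norm_fun h \<cdot> a\<^sup>2 \<equiv> - norm_fun h \<cdot> s'\<close>; so \<open>P\<close> contains the
  witness \<open>t\<^sup>2 + norm_fun h \<cdot> s'\<close>.
\<close>

lemma maximal_avoiding_quaternionic:
  assumes max: "maximal_avoiding f P" and f: "f \<in> qpoly_funs"
  shows "quaternionic_ideal P"
proof -
  have P: "ideal P qpoly_ring" and avoid: "P \<inter> radical_witnesses f = {}"
    using max by (simp_all add: maximal_avoiding_def)
  note Pc = ideal_closed[OF P]
  have "g \<in> P" if g: "g \<in> qpoly_funs" and s: "s \<in> sums_of_norms" and gs: "norm_fun g + s \<in> P" for g s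
  proof (rule ccontr)
    assume "g \<notin> P"
    then obtain a g' where a: "a \<in> qpoly_funs" "fun_cnj a = a" "a \<notin> P"
      and g': "g' \<in> qpoly_funs" "norm_fun g = a * a + norm_fun g'"
      using central_component[OF P g] by metis
    let ?s = "norm_fun g' + s"
    have s': "?s \<in> sums_of_norms" "a * a + ?s \<in> P"
      using g' s gs by (auto simp: add.assoc intro: sums_of_norms.norm_add)
    obtain t h where t: "t \<in> radical_witnesses f" "h \<in> qpoly_funs" "t - h * a \<in> P"
      using maximal_avoiding_central[OF max a] .
    have tS: "t \<in> sums_of_norms" using radical_witnesses_sums_of_norms[OF f t(1)] .
    (* t and a are self-conjugate, so conjugating the congruence for h gives one for fun_cnj h;
       the product of the two brings in the norm of h. *)
    have "fun_cnj (t - h * a) = t - fun_cnj h * a"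
    proof -
      have "fun_cnj (t - h * a) = fun_cnj t - fun_cnj (h * a)"
        using fun_cnj_simps(4)[of "t - h * a" "h * a"] by (simp del: fun_cnj_simps)
      then show ?thesis
        using sums_of_norms_self_conjugate[OF tS] a(2) self_conjugate_central[OF a(2)] by simp
    qed
    then have cnj: "t - fun_cnj h * a \<in> P" using ideal_fun_cnj[OF P t(3)] by simp
    have "h * a * (fun_cnj h * a) = norm_fun h * (a * a)"
      using self_conjugate_central[OF a(2), of "fun_cnj h"] by (metis mult.assoc)
    then have "t * t + norm_fun h * ?s =
        (t - h * a) * t + h * a * (t - fun_cnj h * a) + norm_fun h * (a * a + ?s)"
      by (simp add: algebra_simps)
    also have "\<dots> \<in> P"
      by (intro Pc(3) Pc(4)[OF cnj] Pc(4)[OF s'(2)] Pc(5)[OF t(3)])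
        (use t a(1) sums_of_norms_carrier[OF tS] in auto)
    finally have "t * t + norm_fun h * ?s \<in> P" .
    moreover have "t * t + norm_fun h * ?s \<in> radical_witnesses f"
      using f t s'(1)
      by (intro radical_witnesses_add radical_witnesses_mult sums_of_norms_mult_norm)
    ultimately show False using avoid by auto
  qed
  with P show ?thesis unfolding quaternionic_ideal_iff by blast
qed

theorem corollary11:
  fixes I :: "(quat ^ 'n::finite \<Rightarrow> quat) set"
  assumes "ideal I qpoly_ring"
  shows "quaternionic_radical I =
    carrier qpoly_ring \<inter>
    \<Inter> {P. krull_prime_ideal P qpoly_ring \<and> quaternionic_ideal P \<and> I \<subseteq> P}"
proof (intro equalityI subsetI)
  fix f assume f: "f \<in> quaternionic_radical I"
  have "f \<in> P" if "P \<in> {P. krull_prime_ideal P qpoly_ring \<and> quaternionic_ideal P \<and> I \<subseteq> P}" for P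
    using that f by (blast intro: radical_subset_prime_quaternionic)
  moreover have "f \<in> carrier qpoly_ring"
    using f unfolding quaternionic_radical_iff qpoly_ring_simps(1) by (rule conjunct1)
  ultimately show "f \<in> carrier qpoly_ring \<inter>
      \<Inter> {P. krull_prime_ideal P qpoly_ring \<and> quaternionic_ideal P \<and> I \<subseteq> P}"
    by (intro IntI InterI)
next
  fix f assume f: "f \<in> carrier qpoly_ring \<inter>
      \<Inter> {P. krull_prime_ideal P qpoly_ring \<and> quaternionic_ideal P \<and> I \<subseteq> P}"
  then have fR: "f \<in> qpoly_funs" unfolding qpoly_ring_simps(1) by (rule IntD1)
  show "f \<in> quaternionic_radical I"
  proof (rule ccontr)
    assume "f \<notin> quaternionic_radical I"
    then have "I \<inter> radical_witnesses f = {}" using fR unfolding quaternionic_radical_iff by blast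
    from exists_maximal_avoiding[OF assms this]
    obtain P where P: "maximal_avoiding f P" "I \<subseteq> P" .
    have "P \<in> {P. krull_prime_ideal P qpoly_ring \<and> quaternionic_ideal P \<and> I \<subseteq> P}"
      by (intro CollectI conjI maximal_avoiding_prime[OF P(1) fR]
          maximal_avoiding_quaternionic[OF P(1) fR] P(2))
    with IntD2[OF f] have "f \<in> P" by (rule InterD)
    have "ideal P qpoly_ring" and avoid: "P \<inter> radical_witnesses f = {}"
      using P(1) by (simp_all add: maximal_avoiding_def)
    then have "norm_fun f \<in> P"
      using \<open>f \<in> P\<close> fR by (intro ideal_closed(5)) auto
    then show False using avoid norm_in_radical_witnesses[of f] by blast
  qed
qed

end
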